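(* Let $q\ge 5$ be a prime power. In $\mathrm{PG}(2,q)$, let $P$ be a point of the conic $\mathcal{K}$ and let $\mathcal{K}^*=\mathcal{K}\setminus\{P\}$. Then the non-zero values $c_i$ for the arc $\mathcal{K}^*$ are exactly the following. (i) If $q$ is odd: $c_{(q-1)/2}=\frac{q^2+q}{2}$, $c_{(q-3)/2}=\frac{q^2-q}{2}$, $c_0=1$. (ii) If $q$ is even: $c_{q/2}=q-1$, $c_{(q-2)/2}=q^2-q$, $c_0=2$.
   Context: The conic is $\mathcal{K}=\{(1,t,t^2):t\in\mathbb{F}_q\}\cup\{(0,0,1)\}\subset\mathrm{PG}(2,q)$ (homogeneous coordinates), a set of $q+1$ points no three of which are collinear. A bisecant of an arc (a set of points no three collinear) is a line meeting it in exactly two points. For an arc in $\mathrm{PG}(2,q)$, $c_i$ denotes the number of points of $\mathrm{PG}(2,q)$ not on the arc that lie on exactly $i$ bisecants of the arc. *)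

theory Defs
  imports "HOL-Analysis.Cartesian_Space"
begin

text \<open>
  The plane PG(2,q) over a finite field \<open>'a\<close> with \<open>q\<close> elements: its points and lines are the
  one- and two-dimensional subspaces of \<open>'a ^ 3\<close>, and incidence is inclusion of subspaces.
\<close>

definition pg_points :: "('a::{field,finite} ^ 3) set set" where
  "pg_points = {X. vec.subspace X \<and> vec.dim X = 1}"

definition pg_lines :: "('a::{field,finite} ^ 3) set set" where
  "pg_lines = {l. vec.subspace l \<and> vec.dim l = 2}"

text \<open>The point with homogeneous coordinates \<open>(x, y, z)\<close>, not all zero.\<close>

definition hpoint :: "'a::{field,finite} \<Rightarrow> 'a \<Rightarrow> 'a \<Rightarrow> ('a ^ 3) set" where
  "hpoint x y z = vec.span {vector [x, y, z]}"

definition conic :: "('a::{field,finite} ^ 3) set set" where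
  "conic = {hpoint 1 t (t ^ 2) | t. True} \<union> {hpoint 0 0 1}"

text \<open>Bisecants and the numbers \<open>c\<^sub>i = bisecant_count A i\<close> make sense for every set \<open>A\<close> of points, arc or not.\<close>

definition bisecants :: "('a::{field,finite} ^ 3) set set \<Rightarrow> ('a ^ 3) set set" where
  "bisecants A = {l \<in> pg_lines. card {X \<in> A. X \<subseteq> l} = 2}"

definition bisecant_count :: "('a::{field,finite} ^ 3) set set \<Rightarrow> nat \<Rightarrow> nat" where
  "bisecant_count A i = card {X \<in> pg_points - A. card {l \<in> bisecants A. X \<subseteq> l} = i}"

end

theory Submission
  imports Defs
begin

text \<open>
  A projectivity preserving the conic moves \<open>P\<close> to \<open>(0, 0, 1)\<close>, leaving the arc of the points
  \<open>(1, t, t\<^sup>2)\<close>. The points with parameters \<open>s \<noteq> t\<close> are collinear with \<open>(x, y, z)\<close> iff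
  \<open>x s t - y (s + t) + z = 0\<close>, and for a point off the arc each \<open>s\<close> has at most one partner \<open>t\<close>, so
  the number of bisecants is half the number of \<open>s\<close> that have one. At \<open>(0, 1, z)\<close> the condition
  reads \<open>s + t = z\<close>; at \<open>(1, y, y\<^sup>2 - d)\<close> it reads \<open>(s - y) (t - y) = d\<close>. Parameters without a
  partner thus come from the solutions of \<open>2 s = z\<close> and \<open>u\<^sup>2 = d\<close>, which are counted according to
  the characteristic.
\<close>

section \<open>Parametrisation of the conic and collinearity with two of its points\<close>

definition veronese :: "'a::{field,finite} \<Rightarrow> 'a ^ 3" where
  "veronese t = vector [1, t, t\<^sup>2]"

lemma vector_3_eq_iff:
  "(vector [x, y, z] :: 'a::zero ^ 3) = vector [x', y', z'] \<longleftrightarrow> x = x' \<and> y = y' \<and> z = z'"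
  by (auto simp: vec_eq_iff forall_3)

lemma scale_vector_3: "(k::'a::field) *s (vector [x, y, z] :: 'a ^ 3) = vector [k * x, k * y, k * z]"
  by (simp add: vec_eq_iff forall_3)

lemma vector_3_eq_0_iff: "(vector [x, y, z] :: 'a::zero ^ 3) = 0 \<longleftrightarrow> x = 0 \<and> y = 0 \<and> z = 0"
  by (auto simp: vec_eq_iff forall_3)

lemma veronese_in_span_iff: "veronese s \<in> vec.span {veronese t} \<longleftrightarrow> s = t"
  unfolding veronese_def
  by (auto simp: vec.span_singleton scale_vector_3 vector_3_eq_iff intro!: image_eqI[of _ _ 1])

lemma veronese_nonzero: "veronese t \<noteq> 0"
  by (simp add: veronese_def vector_3_eq_0_iff)

lemma in_span_pair_iff:
  "(v :: 'a::field ^ 'n) \<in> vec.span {a, b} \<longleftrightarrow> (\<exists>h k. v = h *s a + k *s b)"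
proof -
  have "v \<in> vec.span {a, b} \<longleftrightarrow> (\<exists>h k. v - h *s a = k *s b)"
    by (auto simp: vec.span_breakdown_eq[of v a] vec.span_singleton)
  then show ?thesis by (simp add: diff_eq_eq add.commute)
qed

text \<open>The determinant with rows (x, y, z), (1, s, s^2), (1, t, t^2) equals t - s times the
  left-hand side of the equation, and t - s is non-zero.\<close>

lemma in_span_veronese_iff:
  assumes "s \<noteq> t"
  shows "vector [x, y, z] \<in> vec.span {veronese s, veronese t} \<longleftrightarrow> x * s * t - y * (s + t) + z = 0"
proof
  assume "vector [x, y, z] \<in> vec.span {veronese s, veronese t}"
  then obtain h k where "vector [x, y, z] = h *s veronese s + k *s veronese t"
    by (auto simp: in_span_pair_iff)
  then have "x = h + k" "y = h * s + k * t" "z = h * s\<^sup>2 + k * t\<^sup>2"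
    by (simp_all add: veronese_def vec_eq_iff forall_3)
  then show "x * s * t - y * (s + t) + z = 0"
    by (simp add: algebra_simps power2_eq_square)
next
  assume eq: "x * s * t - y * (s + t) + z = 0"
  \<comment> \<open>Cramer's rule for the first two coordinates; the third coordinate then agrees
    because of \<open>eq\<close>.\<close>
  define h k where "h = (y - x * t) / (s - t)" and "k = (x * s - y) / (s - t)"
  have h: "h * (s - t) = y - x * t" and k: "k * (s - t) = x * s - y"
    using assms by (simp_all add: h_def k_def)
  have nz: "s - t \<noteq> 0" using assms by simp
  have "(h + k) * (s - t) = x * (s - t)"
    using h k by algebra
  then have x: "x = h + k" using nz by simp
  have "(h * s + k * t) * (s - t) = y * (s - t)"
    using h k by algebra
  then have y: "y = h * s + k * t" using nz by simp
  have "(h * s\<^sup>2 + k * t\<^sup>2) * (s - t) = z * (s - t)"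
    using h k eq by algebra
  then have z: "z = h * s\<^sup>2 + k * t\<^sup>2" using nz by simp
  have "vector [x, y, z] = h *s veronese s + k *s veronese t"
    using x y z by (simp add: veronese_def vec_eq_iff forall_3)
  then show "vector [x, y, z] \<in> vec.span {veronese s, veronese t}"
    by (auto simp: in_span_pair_iff)
qed

text \<open>When (x, y, z) is itself the conic point with parameter u, the collinearity form factors
  as (u - s) (u - t). So a secant contains no third point of the arc.\<close>

lemma veronese_in_span_pair_iff:
  assumes "s \<noteq> t"
  shows "veronese u \<in> vec.span {veronese s, veronese t} \<longleftrightarrow> u = s \<or> u = t"
proof -
  have "1 * s * t - u * (s + t) + u\<^sup>2 = (u - s) * (u - t)"
    by (simp add: algebra_simps power2_eq_square)
  then show ?thesis
    unfolding veronese_def[of u] by (simp add: in_span_veronese_iff[OF assms])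
qed

section \<open>Lines of the plane and bisecants of the affine arc\<close>

lemma span_pair_in_pg_lines:
  assumes "a \<notin> vec.span {b}" "b \<noteq> 0"
  shows "vec.span {a, b} \<in> pg_lines"
  using assms by (simp add: pg_lines_def vec.dim_insert)

lemma pg_line_eq_span_pair:
  assumes "l \<in> pg_lines" "a \<in> l" "b \<in> l" "a \<notin> vec.span {b}" "b \<noteq> 0"
  shows "l = vec.span {a, b}"
proof -
  have "vec.subspace l" "vec.dim l = 2" using assms(1) by (auto simp: pg_lines_def)
  moreover have "vec.dim (vec.span {a, b}) = 2"
    using span_pair_in_pg_lines[OF assms(4,5)] by (auto simp: pg_lines_def)
  moreover have "vec.span {a, b} \<subseteq> l"
    using assms(2,3) \<open>vec.subspace l\<close> by (intro vec.span_minimal) auto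
  ultimately show ?thesis
    by (metis vec.subspace_dim_equal vec.subspace_span order_refl)
qed

text \<open>The conic without \<open>hpoint 0 0 1\<close>: the normal form to which every
  \<open>conic - {P}\<close> is brought.\<close>

definition affine_conic :: "('a::{field,finite} ^ 3) set set" where
  "affine_conic = range (\<lambda>t. vec.span {veronese t})"

lemma span_singleton_subset_iff:
  assumes "vec.subspace l"
  shows "vec.span {v} \<subseteq> l \<longleftrightarrow> v \<in> l"
  using assms vec.span_minimal[of "{v}" l] vec.span_base[of v "{v}"] by auto

lemma span_singleton_subset_pg_line_iff:
  assumes "l \<in> pg_lines"
  shows "vec.span {v} \<subseteq> l \<longleftrightarrow> v \<in> l"
  using assms by (simp add: pg_lines_def span_singleton_subset_iff)

lemma inj_span_veronese: "inj (\<lambda>t. vec.span {veronese t})"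
  by (rule injI) (metis veronese_in_span_iff vec.span_base singletonI)

text \<open>Distinct parameters give distinct points, so arc points on a line may be counted by
  their parameters.\<close>

lemma bisecants_affine_conic:
  "bisecants affine_conic = {l \<in> pg_lines. card {t. veronese t \<in> l} = 2}"
proof -
  have "card {X \<in> affine_conic. X \<subseteq> l} = card {t. veronese t \<in> l}" if "l \<in> pg_lines"
    for l :: "('a::{field,finite} ^ 3) set"
  proof -
    have "{X \<in> affine_conic. X \<subseteq> l} = (\<lambda>t. vec.span {veronese t}) ` {t. veronese t \<in> l}"
      using span_singleton_subset_pg_line_iff[OF that] by (auto simp: affine_conic_def)
    then show ?thesis
      by (simp add: card_image inj_on_subset[OF inj_span_veronese])
  qed
  then show ?thesis unfolding bisecants_def by (intro Collect_cong conj_cong) simp_all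
qed

text \<open>Double counting of the pairs of a bisecant through \<open>(x, y, z)\<close> and a point of the arc on it.\<close>

lemma card_bisecants_through:
  fixes x y z :: "'a::{field,finite}"
  assumes "vec.span {vector [x, y, z]} \<notin> affine_conic" "(x, y, z) \<noteq> (0, 0, 0)"
  shows "2 * card {l \<in> bisecants affine_conic. vec.span {vector [x, y, z]} \<subseteq> l} =
         card {s. \<exists>t. t \<noteq> s \<and> x * s * t - y * (s + t) + z = 0}"
proof -
  define w :: "'a ^ 3" where "w = vector [x, y, z]"
  define S where "S = {s. \<exists>t. t \<noteq> s \<and> x * s * t - y * (s + t) + z = 0}"
  define T where "T = {l \<in> bisecants affine_conic. vec.span {w} \<subseteq> l}"
  have w0: "w \<noteq> 0" using assms(2) by (simp add: w_def vector_3_eq_0_iff)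
  have w: "w \<notin> vec.span {veronese s}" for s
  proof
    assume *: "w \<in> vec.span {veronese s}"
    then have "vec.span {w} = vec.span {veronese s}"
      using w0 by (intro vec.subspace_dim_equal)
        (auto simp: span_singleton_subset_iff veronese_nonzero)
    then show False using assms(1) by (auto simp: affine_conic_def w_def)
  qed
  have T_iff: "l \<in> T \<longleftrightarrow> l \<in> pg_lines \<and> card {t. veronese t \<in> l} = 2 \<and> w \<in> l" for l
    using span_singleton_subset_pg_line_iff[of l w] by (auto simp: T_def bisecants_affine_conic)
  \<comment> \<open>The two arc points on a bisecant through \<open>w\<close> are partners of each
    other, hence both parameters lie in \<open>S\<close>.\<close>
  have two: "card {s \<in> S. veronese s \<in> l} = 2" if l: "l \<in> T" for l
  proof -
    obtain a b where ab: "{t. veronese t \<in> l} = {a, b}" "a \<noteq> b"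
      using l unfolding T_iff card_2_iff by auto
    then have "veronese a \<in> l" "veronese b \<in> l" by auto
    then have "l = vec.span {veronese a, veronese b}"
      using l ab(2) by (intro pg_line_eq_span_pair)
        (auto simp: T_iff veronese_in_span_iff veronese_nonzero)
    then have "x * a * b - y * (a + b) + z = 0"
      using l ab(2) in_span_veronese_iff[OF ab(2), of x y z] by (simp add: T_iff w_def)
    then have "a \<in> S" "b \<in> S"
      using ab(2) by (auto simp: S_def ac_simps intro: exI[of _ b] exI[of _ a])
    then have "{s \<in> S. veronese s \<in> l} = {a, b}" using ab by auto
    then show ?thesis using ab by simp
  qed
  \<comment> \<open>Existence: the join of s with a partner t is a bisecant containing
    \<open>w\<close>.\<close>
  have one: "card {l \<in> T. veronese s \<in> l} = 1" if s: "s \<in> S" for s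
  proof -
    obtain t where "t \<noteq> s" and eq: "x * s * t - y * (s + t) + z = 0"
      using s unfolding S_def by blast
    note t = \<open>t \<noteq> s\<close>[symmetric] eq
    let ?m = "vec.span {veronese s, veronese t}"
    have "{u. veronese u \<in> ?m} = {s, t}"
      by (auto simp: veronese_in_span_pair_iff[OF t(1)])
    moreover have "?m \<in> pg_lines"
      using t(1) by (intro span_pair_in_pg_lines) (auto simp: veronese_in_span_iff veronese_nonzero)
    moreover have "w \<in> ?m" unfolding w_def by (rule in_span_veronese_iff[THEN iffD2, OF t])
    ultimately have m: "?m \<in> T" "veronese s \<in> ?m" using t(1)
      by (auto simp: T_iff vec.span_base)
    \<comment> \<open>Uniqueness: since \<open>w\<close> is not on the arc, \<open>w\<close> and
      \<open>veronese s\<close> already determine the line.\<close>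
    have "l = vec.span {w, veronese s}" if "l \<in> T" "veronese s \<in> l" for l
      using that w by (intro pg_line_eq_span_pair) (auto simp: T_iff veronese_nonzero)
    then have "{l \<in> T. veronese s \<in> l} = {?m}" using m by blast
    then show ?thesis by simp
  qed
  have "2 * card T = (\<Sum>s\<in>S. card {l \<in> T. veronese s \<in> l})"
    using two by (intro sum_multicount[symmetric]) auto
  also have "\<dots> = card S" using one by simp
  finally show ?thesis by (simp add: T_def S_def w_def)
qed

section \<open>Invariance of the bisecant counts under projectivities\<close>

lemma subspace_dim_linear_inj_image:
  assumes lin: "Vector_Spaces.linear (*s) (*s) (L :: 'a::{field,finite} ^ 3 \<Rightarrow> 'a ^ 3)" and "inj L"
  shows "vec.subspace (L ` X) \<longleftrightarrow> vec.subspace X" "vec.dim (L ` X) = vec.dim X"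
proof -
  show "vec.dim (L ` X) = vec.dim X"
    using assms by (intro vec.dim_image_eq) (auto intro: inj_on_subset)
  show "vec.subspace (L ` X) \<longleftrightarrow> vec.subspace X"
  proof
    assume "vec.subspace (L ` X)"
    then have "vec.subspace (L -` (L ` X))"
      using vec.linear_subspace_vimage[OF lin] by simp
    then show "vec.subspace X" by (simp add: inj_vimage_image_eq \<open>inj L\<close>)
  qed (rule vec.linear_subspace_image[OF lin])
qed

text \<open>Serves two purposes: \<open>g\<close> is the action of a projectivity on sets of
  vectors, and later a translation of parameters.\<close>

lemma card_Collect_image_bij:
  assumes "bij g" "\<And>x. Q (g x) \<longleftrightarrow> R x"
  shows "card {y. Q y} = card {x. R x}"
proof -
  have "{y. Q y} = g ` {x. R x}"
    using assms by (auto simp: bij_def) (metis rangeE UNIV_I image_eqI mem_Collect_eq)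
  then show ?thesis
    using assms(1) by (metis bij_betw_imp_inj_on card_image inj_on_subset subset_UNIV)
qed

text \<open>Taking images under \<open>L\<close> is a bijection on all sets of vectors, so one map
  handles points and lines alike. It respects inclusion, being a subspace, and dimension, from which
  bisecants and their counts are built.\<close>

lemma bisecant_count_linear_image:
  assumes lin: "Vector_Spaces.linear (*s) (*s) (L :: 'a::{field,finite} ^ 3 \<Rightarrow> 'a ^ 3)" and inj: "inj L"
  shows "bisecant_count ((`) L ` A) i = bisecant_count A i"
proof -
  have "bij L" using inj by (simp add: bij_def finite_UNIV_inj_surj)
  then have bij: "bij ((`) L)" by (metis bij_betw_Pow Pow_UNIV)
  note L = subspace_dim_linear_inj_image[OF lin inj]
  have mem: "L ` X \<in> (`) L ` A \<longleftrightarrow> X \<in> A" for X A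
    using bij by (auto simp: bij_def inj_image_mem_iff)
  have sub: "L ` X \<subseteq> L ` Y \<longleftrightarrow> X \<subseteq> Y" for X Y
    using inj by (rule inj_image_subset_iff)
  have bis: "L ` l \<in> bisecants ((`) L ` A) \<longleftrightarrow> l \<in> bisecants A" for l
  proof -
    have "card {X. X \<in> (`) L ` A \<and> X \<subseteq> L ` l} = card {X. X \<in> A \<and> X \<subseteq> l}"
      using bij by (rule card_Collect_image_bij) (simp add: mem sub)
    then show ?thesis by (simp add: bisecants_def pg_lines_def L)
  qed
  have "card {l. l \<in> bisecants ((`) L ` A) \<and> L ` X \<subseteq> l} = card {l. l \<in> bisecants A \<and> X \<subseteq> l}" for X
    using bij by (rule card_Collect_image_bij) (simp add: bis sub)
  then have "card {X. X \<in> pg_points - (`) L ` A \<and> card {l. l \<in> bisecants ((`) L ` A) \<and> X \<subseteq> l} = i} =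
    card {X. X \<in> pg_points - A \<and> card {l. l \<in> bisecants A \<and> X \<subseteq> l} = i}"
    using bij by (intro card_Collect_image_bij[of "(`) L"]) (simp_all add: mem L pg_points_def)
  then show ?thesis by (simp add: bisecant_count_def)
qed

section \<open>Moving the removed point to (0, 0, 1)\<close>

lemma hpoint_scale:
  assumes "k \<noteq> 0"
  shows "hpoint (k * x) (k * y) (k * z) = hpoint x y (z :: 'a::{field,finite})"
proof -
  have "vec.span {k *s (vector [x, y, z] :: 'a ^ 3)} = vec.span {vector [x, y, z]}"
    by (rule vec.span_eq[THEN iffD2])
      (auto simp: vec.span_singleton assms intro: image_eqI[of _ _ "1 / k"])
  then show ?thesis by (simp add: hpoint_def scale_vector_3)
qed

lemma conic_eq: "conic = insert (hpoint 0 0 1) affine_conic"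
  by (auto simp: conic_def affine_conic_def hpoint_def veronese_def)

lemma infinity_notin_affine_conic: "hpoint 0 0 1 \<notin> affine_conic"
proof
  assume "hpoint 0 0 1 \<in> (affine_conic :: ('a ^ 3) set set)"
  then obtain t :: 'a where "vec.span {vector [0, 0, 1]} = vec.span {veronese t}"
    by (auto simp: affine_conic_def hpoint_def)
  then have "vector [0, 0, 1] \<in> vec.span {veronese t}"
    by (metis vec.span_base singletonI)
  then show False
    by (auto simp: veronese_def vec.span_singleton scale_vector_3 vector_3_eq_iff)
qed

lemma bisecant_count_conic_minus_point:
  fixes P :: "('a::{field,finite} ^ 3) set"
  assumes "P \<in> conic"
  shows "bisecant_count (conic - {P}) = bisecant_count (affine_conic :: ('a ^ 3) set set)"
proof (cases "P = hpoint 0 0 1")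
  case True
  have "conic - {P} = affine_conic"
    using infinity_notin_affine_conic unfolding conic_eq True by blast
  then show ?thesis by simp
next
  case False
  then obtain a where a: "P = hpoint 1 a (a\<^sup>2)" using assms by (auto simp: conic_def)
  \<comment> \<open>On parameters of the conic, \<open>L\<close> acts as \<open>t \<mapsto> 1 / (t - a)\<close>.\<close>
  define L :: "'a ^ 3 \<Rightarrow> 'a ^ 3" where
    "L v = vector [v $ 3 - 2 * a * v $ 2 + a\<^sup>2 * v $ 1, v $ 2 - a * v $ 1, v $ 1]" for v
  have lin: "Vector_Spaces.linear (*s) (*s) L"
    by (auto simp: Vector_Spaces.linear_iff vec.vector_space_axioms L_def vec_eq_iff forall_3 algebra_simps)
  have inj: "inj L"
  proof (rule injI)
    fix v w assume "L v = L w"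
    \<comment> \<open>The map is triangular: the last coordinate of the image gives
      \<open>v $ 1\<close>, the middle one then \<open>v $ 2\<close>, and the first one
      \<open>v $ 3\<close>.\<close>
    then show "v = w" unfolding L_def vector_3_eq_iff by (auto simp: vec_eq_iff forall_3)
  qed
  have im: "L ` hpoint x y z = hpoint (z - 2 * a * y + a\<^sup>2 * x) (y - a * x) x" for x y z
  proof -
    have "L (vector [x, y, z]) = vector [z - 2 * a * y + a\<^sup>2 * x, y - a * x, x]"
      by (simp add: L_def)
    then show ?thesis
      using vec.linear_span_image[OF lin, of "{vector [x, y, z]}"] by (simp add: hpoint_def)
  qed
  have imP: "L ` P = hpoint 0 0 1"
    by (simp add: a im power2_eq_square)
  have "L ` hpoint 1 t (t\<^sup>2) \<in> conic" for t
  proof (cases "t = a")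
    case True
    then show ?thesis using imP a by (simp add: conic_def)
  next
    case False
    define u where "u = 1 / (t - a)"
    have u: "(t - a) * u = 1" using False by (simp add: u_def)
    \<comment> \<open>The image has coordinates ((t - a)^2, t - a, 1); extracting the factor (t -
      a)^2 leaves (1, u, u^2).\<close>
    have "L ` hpoint 1 t (t\<^sup>2) = hpoint ((t - a)\<^sup>2 * 1) ((t - a)\<^sup>2 * u) ((t - a)\<^sup>2 * u\<^sup>2)"
    proof -
      have "t\<^sup>2 - 2 * a * t + a\<^sup>2 * 1 = (t - a)\<^sup>2 * 1" by (simp add: power2_eq_square algebra_simps)
      moreover have "t - a * 1 = (t - a)\<^sup>2 * u" using u by algebra
      moreover have "1 = (t - a)\<^sup>2 * u\<^sup>2" using u by algebra
      ultimately show ?thesis unfolding im by metis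
    qed
    also have "\<dots> = hpoint 1 u (u\<^sup>2)" using False by (intro hpoint_scale) simp
    finally show ?thesis by (auto simp: conic_def)
  qed
  \<comment> \<open>The image is (1, 0, 0), the conic point with parameter 0.\<close>
  moreover have "L ` hpoint 0 0 1 \<in> conic" by (auto simp: im conic_def intro!: exI[of _ 0])
  ultimately have "(`) L ` conic \<subseteq> conic" by (auto simp: conic_def)
  moreover have inj': "inj ((`) L)" using inj by (simp add: inj_def inj_image_eq_iff)
  \<comment> \<open>An injective map of a finite set into itself is onto, so no preimages need to be
    computed.\<close>
  ultimately have "(`) L ` conic = conic"
    by (intro endo_inj_surj) (auto intro: inj_on_subset)
  then have "(`) L ` (conic - {P}) = conic - {hpoint 0 0 1}"
    using inj' imP by (simp add: image_set_diff)
  also have "\<dots> = affine_conic"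
    using infinity_notin_affine_conic unfolding conic_eq by blast
  finally show ?thesis
    using bisecant_count_linear_image[OF lin inj] by (metis ext)
qed


section \<open>Normal forms of the points off the arc\<close>

lemma hpoint_eqD:
  assumes "hpoint x y z = hpoint x' y' (z' :: 'a::{field,finite})"
  shows "\<exists>k. x = k * x' \<and> y = k * y' \<and> z = k * z'"
proof -
  have "(vector [x, y, z] :: 'a ^ 3) \<in> vec.span {vector [x', y', z']}"
    using assms unfolding hpoint_def by (metis vec.span_base singletonI)
  then show ?thesis by (auto simp: vec.span_singleton scale_vector_3 vector_3_eq_iff)
qed

lemma hpoint_1_eq_iff: "hpoint 1 y z = hpoint 1 y' z' \<longleftrightarrow> y = y' \<and> z = z'"
  by (metis hpoint_eqD mult_1 mult.comm_neutral)

lemma hpoint_0_1_eq_iff: "hpoint 0 1 z = hpoint 0 1 z' \<longleftrightarrow> z = z'"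
  by (metis hpoint_eqD mult_1 mult.comm_neutral)

lemma affine_conic_eq_range_hpoint: "affine_conic = range (\<lambda>t. hpoint 1 t (t\<^sup>2))"
  by (simp add: affine_conic_def hpoint_def veronese_def)

lemma hpoint_in_pg_points:
  assumes "(x, y, z) \<noteq> (0, 0, 0)"
  shows "hpoint x y z \<in> pg_points"
  using assms by (simp add: hpoint_def pg_points_def vector_3_eq_0_iff)

lemma pg_pointE:
  assumes "X \<in> (pg_points :: ('a::{field,finite} ^ 3) set set)"
  obtains x y z where "X = hpoint x y z" "(x, y, z) \<noteq> (0, 0, 0)"
proof -
  have X: "vec.subspace X" "vec.dim X = 1" using assms by (auto simp: pg_points_def)
  then have "\<not> X \<subseteq> {0}" using vec.dim_eq_0[of X] by simp
  then obtain v where v: "v \<in> X" "v \<noteq> 0" by auto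
  then have "vec.span {v} = X"
    using X by (intro vec.subspace_dim_equal) (auto simp: span_singleton_subset_iff[THEN iffD2])
  moreover have "v = vector [v $ 1, v $ 2, v $ 3]" by (simp add: vec_eq_iff forall_3)
  ultimately show ?thesis
    using that[of "v $ 1" "v $ 2" "v $ 3"] v(2) vector_3_eq_0_iff[of "v $ 1" "v $ 2" "v $ 3"]
    by (auto simp: hpoint_def)
qed

text \<open>Normalise the first non-zero coordinate to 1. The first two pieces make up the line x =
  0, the tangent of the full conic at (0, 0, 1). Off that line, d = y^2 - z is the value of the
  quadratic form y^2 - x z, which vanishes exactly on the arc.\<close>

lemma pg_points_minus_affine_conic:
  "pg_points - affine_conic =
     {hpoint 0 0 1} \<union> range (hpoint 0 1) \<union> (\<lambda>(y, d). hpoint 1 y (y\<^sup>2 - d)) ` (UNIV \<times> - {0 :: 'a::{field,finite}})"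
  (is "?L = ?R")
proof
  show "?L \<subseteq> ?R"
  proof
    fix X :: "('a ^ 3) set" assume X: "X \<in> ?L"
    then obtain x y z where xyz: "X = hpoint x y z" "(x, y, z) \<noteq> (0, 0, 0)"
      using pg_pointE[of X] by blast
    consider "x \<noteq> 0" | "x = 0" "y \<noteq> 0" | "x = 0" "y = 0" "z \<noteq> 0" using xyz(2) by auto
    then show "X \<in> ?R"
    proof cases
      case 1
      then have eq: "X = hpoint 1 (y / x) (z / x)"
        using hpoint_scale[of x 1 "y / x" "z / x"] xyz(1) by simp
      define d where "d = (y / x)\<^sup>2 - z / x"
      have eq': "X = hpoint 1 (y / x) ((y / x)\<^sup>2 - d)" using eq by (simp add: d_def)
      have "d \<noteq> 0" using X eq' by (auto simp: affine_conic_eq_range_hpoint)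
      then show ?thesis using eq' by (auto intro!: image_eqI[of _ _ "(y / x, d)"])
    next
      case 2
      then have "X = hpoint 0 1 (z / y)" using hpoint_scale[of y 0 1 "z / y"] xyz(1) by simp
      then show ?thesis by auto
    next
      case 3
      then have "X = hpoint 0 0 1" using hpoint_scale[of z 0 0 1] xyz(1) by simp
      then show ?thesis by auto
    qed
  qed
  show "?R \<subseteq> ?L"
    using infinity_notin_affine_conic
    by (auto simp: hpoint_in_pg_points) (auto simp: affine_conic_eq_range_hpoint dest!: hpoint_eqD)
qed

section \<open>Number of bisecants through each point\<close>

definition bisecant_degree :: "('a::{field,finite} ^ 3) set \<Rightarrow> nat" where
  "bisecant_degree X = card {l \<in> bisecants affine_conic. X \<subseteq> l}"

lemma double_bisecant_degree:
  assumes "hpoint x y z \<notin> affine_conic" "(x, y, z) \<noteq> (0, 0, 0)"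
  shows "2 * bisecant_degree (hpoint x y z) = card {s. \<exists>t. t \<noteq> s \<and> x * s * t - y * (s + t) + z = 0}"
  using card_bisecants_through[of x y z] assms by (simp add: bisecant_degree_def hpoint_def)

text \<open>Here the collinearity condition reads 1 = 0, so no parameter has a partner.\<close>

lemma bisecant_degree_infinity: "bisecant_degree (hpoint 0 0 1) = 0"
  using double_bisecant_degree[of 0 0 1] infinity_notin_affine_conic by simp

text \<open>The only candidate partner of s is z - s, and it differs from s unless s + s = z. The
  additive form covers every characteristic and avoids truncated subtraction.\<close>

lemma bisecant_degree_tangent:
  fixes z :: "'a::{field,finite}"
  shows "2 * bisecant_degree (hpoint 0 1 z) + card {s. s + s = z} = CARD('a)"
proof -
  have "(\<exists>t. t \<noteq> s \<and> 0 * s * t - 1 * (s + t) + z = 0) \<longleftrightarrow> s + s \<noteq> z" for s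
  proof
    assume "s + s \<noteq> z"
    then have "z - s \<noteq> s" by (auto simp: algebra_simps)
    then show "\<exists>t. t \<noteq> s \<and> 0 * s * t - 1 * (s + t) + z = 0" by (intro exI[of _ "z - s"]) simp
  qed (auto simp: algebra_simps)
  moreover have "hpoint 0 1 z \<notin> affine_conic" using pg_points_minus_affine_conic by blast
  ultimately have "2 * bisecant_degree (hpoint 0 1 z) = card {s. s + s \<noteq> z}"
    using double_bisecant_degree[of 0 1 z] by simp
  also have "{s. s + s \<noteq> z} = UNIV - {s. s + s = z}" by auto
  finally show ?thesis by (simp add: card_Diff_subset card_mono)
qed

text \<open>The candidate partner of the parameter s + y is d / s + y. It coincides with s + y when
  s^2 = d, where the line is a tangent. The summand 1 is for s = 0: the join with (1, y, y^2) passes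
  through the removed point (0, 0, 1) and has no second arc point.\<close>

lemma bisecant_degree_generic:
  fixes d :: "'a::{field,finite}"
  assumes "d \<noteq> 0"
  shows "2 * bisecant_degree (hpoint 1 y (y\<^sup>2 - d)) + card {u. u\<^sup>2 = d} + 1 = CARD('a)"
proof -
  have "(\<exists>t. t \<noteq> s + y \<and> 1 * (s + y) * t - y * (s + y + t) + (y\<^sup>2 - d) = 0) \<longleftrightarrow> s \<noteq> 0 \<and> s\<^sup>2 \<noteq> d"
    (is "?l \<longleftrightarrow> ?r") for s
  proof -
    have eq: "1 * (s + y) * t - y * (s + y + t) + (y\<^sup>2 - d) = s * (t - y) - d" for t
      by (simp add: algebra_simps power2_eq_square)
    show ?thesis unfolding eq
    proof
      assume r: ?r
      then have "d / s \<noteq> s" by (auto simp: power2_eq_square field_simps)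
      then show "\<exists>t. t \<noteq> s + y \<and> s * (t - y) - d = 0" using r by (intro exI[of _ "d / s + y"]) simp
    next
      assume "\<exists>t. t \<noteq> s + y \<and> s * (t - y) - d = 0"
      then obtain t where t: "t \<noteq> s + y" "s * (t - y) = d" by auto
      then have s: "s \<noteq> 0" using assms by auto
      moreover have "s\<^sup>2 \<noteq> d"
      proof
        assume "s\<^sup>2 = d"
        then have "s * (t - y) = s * s" using t(2) by (simp add: power2_eq_square)
        then have "t - y = s" using s by simp
        then have "t = s + y" by (simp add: diff_eq_eq)
        then show False using t(1) by simp
      qed
      ultimately show ?r by simp
    qed
  qed
  \<comment> \<open>The equivalence above is stated for the shifted parameter s + y; the shift is
    undone by this bijection.\<close>
  moreover have "bij (\<lambda>s. s + y)" by (rule bij_betw_byWitness[of _ "\<lambda>s. s - y"]) auto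
  ultimately have "card {s. \<exists>t. t \<noteq> s \<and> 1 * s * t - y * (s + t) + (y\<^sup>2 - d) = 0} = card {u. u \<noteq> 0 \<and> u\<^sup>2 \<noteq> d}"
    by (intro card_Collect_image_bij)
  moreover have "hpoint 1 y (y\<^sup>2 - d) \<notin> affine_conic"
    using assms by (auto simp: affine_conic_eq_range_hpoint dest!: hpoint_eqD)
  ultimately have "2 * bisecant_degree (hpoint 1 y (y\<^sup>2 - d)) = card {u. u \<noteq> 0 \<and> u\<^sup>2 \<noteq> d}"
    using double_bisecant_degree[of 1 y "y\<^sup>2 - d"] by simp
  also have "{u. u \<noteq> 0 \<and> u\<^sup>2 \<noteq> d} = UNIV - insert 0 {u. u\<^sup>2 = d}" by auto
  also have "card \<dots> = CARD('a) - card (insert 0 {u. u\<^sup>2 = d})" by (intro card_Diff_subset) auto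
  also have "card (insert 0 {u. u\<^sup>2 = d}) = card {u. u\<^sup>2 = d} + 1" using assms by simp
  finally have "2 * bisecant_degree (hpoint 1 y (y\<^sup>2 - d)) = CARD('a) - (card {u. u\<^sup>2 = d} + 1)" .
  \<comment> \<open>This bound turns the truncated difference into the additive identity
    claimed.\<close>
  moreover have "card (insert 0 {u. u\<^sup>2 = d}) \<le> CARD('a)" by (intro card_mono) auto
  ultimately show ?thesis using assms by simp
qed

text \<open>The three families of normal forms are disjoint, and the last two are parametrised
  injectively, so counting points becomes counting parameters. The point (0, 0, 1) lies on no
  bisecant and contributes only to i = 0.\<close>

lemma bisecant_count_affine_conic:
  "bisecant_count (affine_conic :: ('a::{field,finite} ^ 3) set set) i =
     of_bool (i = 0) + card {z :: 'a. bisecant_degree (hpoint 0 1 z) = i} +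
     card {(y, d :: 'a). d \<noteq> 0 \<and> bisecant_degree (hpoint 1 y (y\<^sup>2 - d)) = i}"
proof -
  define G :: "'a \<times> 'a \<Rightarrow> ('a ^ 3) set" where "G = (\<lambda>(y, d). hpoint 1 y (y\<^sup>2 - d))"
  define A :: "('a ^ 3) set set" where "A = (if i = 0 then {hpoint 0 0 1} else {})"
  define B where "B = hpoint 0 1 ` {z :: 'a. bisecant_degree (hpoint 0 1 z) = i}"
  define C where "C = G ` {(y, d). d \<noteq> 0 \<and> bisecant_degree (hpoint 1 y (y\<^sup>2 - d)) = i}"
  \<comment> \<open>Stated for arbitrary maps so that selecting by degree distributes over the three
    families without unfolding points.\<close>
  have "{X \<in> {p} \<union> range H \<union> g ` S. b X = i} =
      {X. X = p \<and> b X = i} \<union> H ` {z. b (H z) = i} \<union> g ` {x \<in> S. b (g x) = i}"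
    for p :: "('a ^ 3) set" and H :: "'a \<Rightarrow> ('a ^ 3) set" and g :: "'a \<times> 'a \<Rightarrow> ('a ^ 3) set"
      and S and b :: "('a ^ 3) set \<Rightarrow> nat"
    by auto
  note split = this
  have "{X. X = hpoint 0 0 1 \<and> bisecant_degree X = i} = A"
    using bisecant_degree_infinity[where 'a = 'a] by (auto simp: A_def)
  moreover have "{x \<in> UNIV \<times> - {0}. bisecant_degree (G x) = i} =
      {(y, d). d \<noteq> 0 \<and> bisecant_degree (hpoint 1 y (y\<^sup>2 - d)) = i}"
    by (auto simp: G_def)
  ultimately have "{X \<in> pg_points - affine_conic. bisecant_degree X = i} = A \<union> B \<union> C"
    unfolding pg_points_minus_affine_conic B_def C_def G_def[symmetric] split by (simp only:)
  then have "bisecant_count (affine_conic :: ('a ^ 3) set set) i = card (A \<union> B \<union> C)"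
    by (simp add: bisecant_count_def bisecant_degree_def)
  also have "\<dots> = card A + card B + card C"
  proof -
    have "hpoint 0 0 1 \<noteq> hpoint 0 1 z" "hpoint 0 0 1 \<noteq> G x" "hpoint 0 1 z \<noteq> G x" for z x
      by (auto simp: G_def dest!: hpoint_eqD split: prod.splits)
    then have "A \<inter> B = {}" "(A \<union> B) \<inter> C = {}"
      unfolding A_def B_def C_def by (simp_all add: disjoint_iff image_iff) metis
    then show ?thesis by (simp add: card_Un_disjoint)
  qed
  also have "card A = of_bool (i = 0)" by (simp add: A_def)
  also have "card B = card {z :: 'a. bisecant_degree (hpoint 0 1 z) = i}"
    unfolding B_def by (intro card_image inj_onI) (simp add: hpoint_0_1_eq_iff)
  also have "card C = card {(y, d :: 'a). d \<noteq> 0 \<and> bisecant_degree (hpoint 1 y (y\<^sup>2 - d)) = i}"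
  proof -
    have "inj G" by (rule injI) (auto simp: G_def hpoint_1_eq_iff)
    then show ?thesis unfolding C_def by (intro card_image) (rule inj_on_subset[OF _ subset_UNIV])
  qed
  finally show ?thesis .
qed

section \<open>Square roots and the counts in odd and even characteristic\<close>

lemma square_roots:
  fixes u :: "'a::field"
  shows "{v. v\<^sup>2 = u\<^sup>2} = {u, - u}"
  unfolding power2_eq_iff by blast

lemma card_square_roots:
  assumes "(2 :: 'a::field) \<noteq> 0" "u \<noteq> (0 :: 'a)"
  shows "card {v. v\<^sup>2 = u\<^sup>2} = 2"
proof -
  have "u \<noteq> - u"
  proof
    assume "u = - u"
    then have "2 * u = 0" by (metis add.right_inverse mult_2)
    then show False using assms by simp
  qed
  then show ?thesis by (simp add: square_roots)
qed

text \<open>Squaring is two-to-one on the non-zero elements; count the pairs (u, u^2) in two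
  ways.\<close>

lemma card_nonzero_squares:
  assumes "(2 :: 'a::{field,finite}) \<noteq> 0"
  shows "2 * card {d :: 'a. d \<noteq> 0 \<and> (\<exists>u. u\<^sup>2 = d)} + 1 = CARD('a)"
proof -
  define T where "T = {d :: 'a. d \<noteq> 0 \<and> (\<exists>u. u\<^sup>2 = d)}"
  have "card {u \<in> - {0}. u\<^sup>2 = d} = 2" if d: "d \<in> T" for d
  proof -
    obtain u where ud: "u\<^sup>2 = d" using d unfolding T_def by blast
    with d have u: "u\<^sup>2 = d" "u \<noteq> 0" by (auto simp: T_def)
    then have "{v \<in> - {0}. v\<^sup>2 = d} = {v. v\<^sup>2 = u\<^sup>2}" by auto
    then show ?thesis using card_square_roots[OF assms u(2)] by simp
  qed
  then have "2 * card T = (\<Sum>u\<in>- {0}. card {d \<in> T. u\<^sup>2 = d})"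
    by (intro sum_multicount[symmetric]) simp_all
  also have "\<dots> = (\<Sum>u\<in>- {0 :: 'a}. 1)"
  proof (intro sum.cong refl)
    fix u :: 'a assume "u \<in> - {0}"
    then have "{d \<in> T. u\<^sup>2 = d} = {u\<^sup>2}" by (auto simp: T_def)
    then show "card {d \<in> T. u\<^sup>2 = d} = 1" by simp
  qed
  also have "\<dots> = CARD('a) - 1" by (simp add: Compl_eq_Diff_UNIV card_Diff_singleton)
  finally show ?thesis by (simp add: T_def)
qed

text \<open>There are m non-zero squares and m non-squares. A non-square d gives degree m and a
  non-zero square degree m - 1, for each of the q values of y. The q points (0, 1, z) also have
  degree m, whence q + q m = q (m + 1).\<close>

lemma bisecant_count_affine_conic_odd:
  assumes two: "(2 :: 'a::{field,finite}) \<noteq> 0" and q: "CARD('a) = 2 * m + 1"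
  shows "bisecant_count (affine_conic :: ('a ^ 3) set set) i =
     of_bool (i = 0) + of_bool (i = m) * (CARD('a) * (m + 1)) + of_bool (i + 1 = m) * (CARD('a) * m)"
proof -
  define N where "N = {d :: 'a. d \<noteq> 0 \<and> \<not> (\<exists>u. u\<^sup>2 = d)}"
  define T where "T = {d :: 'a. d \<noteq> 0 \<and> (\<exists>u. u\<^sup>2 = d)}"
  have cT: "card T = m" using card_nonzero_squares[OF two] q by (simp add: T_def)
  have "card (N \<union> T) = card N + card T" by (intro card_Un_disjoint) (auto simp: N_def T_def)
  also have "N \<union> T = - {0}" by (auto simp: N_def T_def)
  finally have cN: "card N = m" using cT q by (simp add: Compl_eq_Diff_UNIV card_Diff_singleton)
  have tangent: "bisecant_degree (hpoint 0 1 z) = m" for z :: 'a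
  proof -
    have "{s. s + s = z} = {z / 2}" using two by (auto simp: field_simps simp flip: mult_2)
    then show ?thesis using bisecant_degree_tangent[of z] q by simp
  qed
  have degN: "bisecant_degree (hpoint 1 y (y\<^sup>2 - d)) = m" if "d \<in> N" for y d
  proof -
    have "{u. u\<^sup>2 = d} = {}" using that by (auto simp: N_def)
    then show ?thesis using bisecant_degree_generic[of d y] q that by (simp add: N_def)
  qed
  have degT: "bisecant_degree (hpoint 1 y (y\<^sup>2 - d)) + 1 = m" if d: "d \<in> T" for y d
  proof -
    obtain u where ud: "u\<^sup>2 = d" using d unfolding T_def by blast
    with d have u: "u\<^sup>2 = d" "u \<noteq> 0" by (auto simp: T_def)
    then have "card {v. v\<^sup>2 = d} = 2" using card_square_roots[OF two u(2)] by simp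
    then show ?thesis using bisecant_degree_generic[of d y] q d by (simp add: T_def)
  qed
  have "{(y, d). d \<noteq> 0 \<and> bisecant_degree (hpoint 1 y (y\<^sup>2 - d)) = i} =
      UNIV \<times> (if i = m then N else if i + 1 = m then T else {})"
  proof -
    have "d \<noteq> 0 \<and> bisecant_degree (hpoint 1 y (y\<^sup>2 - d)) = i \<longleftrightarrow>
        d \<in> (if i = m then N else if i + 1 = m then T else {})" for y d
    proof -
      consider "d = 0" "d \<notin> N" "d \<notin> T" | "d \<noteq> 0" "d \<in> N" "d \<notin> T" | "d \<noteq> 0" "d \<in> T" "d \<notin> N"
        unfolding N_def T_def by blast
      then show ?thesis
      proof cases
        case 2
        then show ?thesis using degN[of d y] by auto
      next
        case 3
        then show ?thesis using degT[of d y] by auto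
      qed simp
    qed
    then show ?thesis by auto
  qed
  then have "card {(y, d :: 'a). d \<noteq> 0 \<and> bisecant_degree (hpoint 1 y (y\<^sup>2 - d)) = i} =
      (of_bool (i = m) + of_bool (i + 1 = m)) * (CARD('a) * m)"
    using cN cT by (auto simp: card_cartesian_product)
  then show ?thesis
    unfolding bisecant_count_affine_conic by (auto simp: tangent)
qed

text \<open>Since s + s = 0, no parameter has a partner at (0, 1, 0), the nucleus of the conic,
  while at the other points (0, 1, z) every parameter has one. Squaring is bijective, so each d has
  one root and the remaining points all have degree m - 1.\<close>

lemma bisecant_count_affine_conic_even:
  assumes two: "(2 :: 'a::{field,finite}) = 0" and q: "CARD('a) = 2 * m"
  shows "bisecant_count (affine_conic :: ('a ^ 3) set set) i =
     2 * of_bool (i = 0) + of_bool (i = m) * (CARD('a) - 1) +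
     of_bool (i + 1 = m) * (CARD('a) * (CARD('a) - 1))"
proof -
  have dbl: "s + s = 0" for s :: 'a using two by (simp flip: mult_2)
  then have neg: "- s = s" for s :: 'a by (metis add_eq_0_iff)
  \<comment> \<open>Keeps the cases i = 0 and i = m apart when the points (0, 1, z) are
    counted.\<close>
  have m: "m \<noteq> 0" using q by (intro notI) simp
  have tangent: "bisecant_degree (hpoint 0 1 z) = (if z = 0 then 0 else m)" for z :: 'a
    using bisecant_degree_tangent[of z] q by (cases "z = 0") (simp_all add: dbl)
  have "inj (\<lambda>u :: 'a. u\<^sup>2)" by (rule injI) (auto simp: power2_eq_iff neg)
  then have "bij (\<lambda>u :: 'a. u\<^sup>2)" by (simp add: bij_def finite_UNIV_inj_surj)
  have root: "card {u. u\<^sup>2 = d} = 1" for d :: 'a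
  proof -
    obtain u where u: "d = u\<^sup>2" using \<open>bij (\<lambda>u :: 'a. u\<^sup>2)\<close> by (metis bij_pointE)
    then have "{v. v\<^sup>2 = d} = {u}" using square_roots[of u] by (auto simp: neg)
    then show ?thesis by simp
  qed
  have deg: "bisecant_degree (hpoint 1 y (y\<^sup>2 - d)) + 1 = m" if "d \<noteq> 0" for y d :: 'a
    using bisecant_degree_generic[OF that, of y] q by (simp add: root)
  have "{(y, d :: 'a). d \<noteq> 0 \<and> bisecant_degree (hpoint 1 y (y\<^sup>2 - d)) = i} =
      UNIV \<times> (if i + 1 = m then - {0} else {})"
    using deg by (auto split: if_splits)
  then have generic: "card {(y, d :: 'a). d \<noteq> 0 \<and> bisecant_degree (hpoint 1 y (y\<^sup>2 - d)) = i} =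
      of_bool (i + 1 = m) * (CARD('a) * (CARD('a) - 1))"
    by (auto simp: card_cartesian_product Compl_eq_Diff_UNIV card_Diff_singleton)
  have "{z :: 'a. bisecant_degree (hpoint 0 1 z) = i} =
      (if i = 0 then {0} else if i = m then - {0} else {})"
    using m by (auto simp: tangent)
  then have "card {z :: 'a. bisecant_degree (hpoint 0 1 z) = i} =
      of_bool (i = 0) + of_bool (i = m) * (CARD('a) - 1)"
    using m by (auto simp: Compl_eq_Diff_UNIV card_Diff_singleton)
  with generic show ?thesis
    unfolding bisecant_count_affine_conic by simp
qed

text \<open>The parity of q is read off from earlier counts. If 2 = 0, then s + s = 1 has no
  solution, so the count at (0, 1, 1) makes q even. Otherwise the number of non-zero squares makes q
  odd.\<close>

lemma odd_CARD_iff: "odd CARD('a) \<longleftrightarrow> (2 :: 'a::{field,finite}) \<noteq> 0"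
proof
  assume odd: "odd CARD('a)"
  show "(2 :: 'a) \<noteq> 0"
  proof
    assume "(2 :: 'a) = 0"
    then have "{s. s + s = (1 :: 'a)} = {}" by simp
    then have "2 * bisecant_degree (hpoint 0 1 (1 :: 'a)) = CARD('a)"
      using bisecant_degree_tangent[of "1 :: 'a"] by simp
    then show False using odd by (metis dvd_triv_left)
  qed
next
  assume "(2 :: 'a) \<noteq> 0"
  from card_nonzero_squares[OF this, symmetric] show "odd CARD('a)" by simp
qed

theorem proposition6p7:
  fixes P :: "('a::{field,finite} ^ 3) set" and q :: nat and c :: "nat \<Rightarrow> nat"
  assumes "q = CARD('a)" and "q \<ge> 5" and "P \<in> conic"
    and "c = bisecant_count (conic - {P})"
  shows "(odd q \<longrightarrow>
           {i. c i \<noteq> 0} = {(q - 1) div 2, (q - 3) div 2, 0} \<and>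
           c ((q - 1) div 2) = (q\<^sup>2 + q) div 2 \<and>
           c ((q - 3) div 2) = (q\<^sup>2 - q) div 2 \<and>
           c 0 = 1) \<and>
         (even q \<longrightarrow>
           {i. c i \<noteq> 0} = {q div 2, (q - 2) div 2, 0} \<and>
           c (q div 2) = q - 1 \<and>
           c ((q - 2) div 2) = q\<^sup>2 - q \<and>
           c 0 = 2)"
proof -
  have c: "c = bisecant_count (affine_conic :: ('a ^ 3) set set)"
    using assms(3,4) bisecant_count_conic_minus_point by simp
  show ?thesis
  proof (cases "odd q")
    case True
    then obtain m where m: "q = 2 * m + 1" by (rule oddE)
    \<comment> \<open>From q at least 5: the indices 0, m - 1 and m are distinct, so the
      contributions do not merge.\<close>
    have m2: "m \<ge> 2" using assms(2) m by simp
    have ci: "c i = of_bool (i = 0) + of_bool (i = m) * (q * (m + 1)) + of_bool (i + 1 = m) * (q * m)" for i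
      unfolding c assms(1)
      using True m assms(1) odd_CARD_iff[where 'a = 'a]
      by (intro bisecant_count_affine_conic_odd) auto
    have "(q - 1) div 2 = m" "(q - 3) div 2 = m - 1" using m by auto
    moreover have "(q\<^sup>2 + q) div 2 = q * (m + 1)" "(q\<^sup>2 - q) div 2 = q * m"
    proof -
      \<comment> \<open>Both numerators are even, so the divisions by 2 are exact.\<close>
      have "q\<^sup>2 + q = 2 * (q * (m + 1))" "q\<^sup>2 - q = 2 * (q * m)"
        by (simp_all add: m power2_eq_square algebra_simps)
      then show "(q\<^sup>2 + q) div 2 = q * (m + 1)" "(q\<^sup>2 - q) div 2 = q * m" by simp_all
    qed
    moreover have "{i. c i \<noteq> 0} = {m, m - 1, 0}" using m m2 by (auto simp: ci)
    moreover have "m - 1 \<noteq> m" "m - 1 \<noteq> 0" using m2 by auto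
    ultimately show ?thesis using True m2 by (simp add: ci)
  next
    case False
    then obtain m where m: "q = 2 * m" by auto
    have m2: "m \<ge> 3" using assms(2) m by simp
    have ci: "c i = 2 * of_bool (i = 0) + of_bool (i = m) * (q - 1) + of_bool (i + 1 = m) * (q * (q - 1))" for i
      unfolding c assms(1)
      using False m assms(1) odd_CARD_iff[where 'a = 'a]
      by (intro bisecant_count_affine_conic_even) auto
    have "q div 2 = m" "(q - 2) div 2 = m - 1" using m by auto
    moreover have "q\<^sup>2 - q = q * (q - 1)" by (simp add: power2_eq_square diff_mult_distrib2)
    moreover have "{i. c i \<noteq> 0} = {m, m - 1, 0}" using m m2 by (auto simp: ci)
    moreover have "m - 1 \<noteq> m" "m - 1 \<noteq> 0" using m2 by auto
    ultimately show ?thesis using False m2 by (simp add: ci)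
  qed
qed

end
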